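(* Let $n>1$ be an odd integer, let $a$ be a real number with $0<a<1$, and let $\alpha\in[0,2\pi)$. Let $g(\alpha,a,n)$ be the pizza inequity function (total area of the even numbered slices minus total area of the odd numbered slices, as defined in the context), and let $f(\alpha,a,n)=g(\alpha,a,n)/a$. Then $$f(\alpha,a,n)=\sum_{m}\frac{4n}{\pi m}\,P_m(a)\,\sin m\alpha,$$ where $m$ ranges over all positive odd multiples of $n$, and $P_m(x)$ is the power series $P_m(x)=\sum_{j=1}^{\infty}c_{2j}(m)x^{2j}$ with $$c_{2j}(m)=(-1)^j\binom{1/2}{j}\int_0^{2\pi}\cos\theta\,\cos m\theta\,\sin^{2j}\theta\,d\theta .$$
   Context: Consider the circular pizza $(x-a)^2+y^2\le 1$, of radius $1$ and center $(a,0)$; since $0<a<1$ the origin is a noncentral interior point. Take the $2n$ rays starting from the origin and making angles $\alpha,\alpha+\pi/n,\ldots,\alpha+(2n-1)\pi/n$ with the positive $x$-axis. They divide the pizza into $2n$ slices, numbered counterclockwise: for $k=1,\dots,2n$ the $k$-th slice is the region of the pizza between the ray at angle $\alpha+(k-1)\pi/n$ and the ray at angle $\alpha+k\pi/n$. The pizza inequity function $g(\alpha,a,n)$ is the total area of the even numbered slices minus the total area of the odd numbered slices. Equivalently, with $r(\theta)=a\cos\theta+\sqrt{1-a^2\sin^2\theta}$ the polar equation of the circle, $A=\bigcup_{k\text{ even},\,1\le k\le 2n}[\alpha+(k-1)\pi/n,\alpha+k\pi/n]$ and $B=\bigcup_{k\text{ odd},\,1\le k\le 2n}[\alpha+(k-1)\pi/n,\alpha+k\pi/n]$,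 one has $2g(\alpha,a,n)=\int_A r(\theta)^2\,d\theta-\int_B r(\theta)^2\,d\theta$. $\binom{1/2}{j}$ denotes the generalized binomial coefficient $\frac{(1/2)(1/2-1)\cdots(1/2-j+1)}{j!}$. *)

theory Defs
  imports "HOL-Analysis.Analysis"
begin

definition pizza :: "real \<Rightarrow> (real^2) set" where
  "pizza a = {z. (z $ 1 - a)\<^sup>2 + (z $ 2)\<^sup>2 \<le> 1}"

definition ray :: "real \<Rightarrow> (real^2) set" where
  "ray \<theta> = {z. \<exists>r\<ge>0. z $ 1 = r * cos \<theta> \<and> z $ 2 = r * sin \<theta>}"

(* Slices are numbered counterclockwise by k = 1, ..., 2n and contain their two boundary rays. *)
definition slice :: "real \<Rightarrow> real \<Rightarrow> nat \<Rightarrow> nat \<Rightarrow> (real^2) set" where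
  "slice \<alpha> a n k =
     pizza a \<inter> (\<Union>\<theta>\<in>{\<alpha> + (real k - 1) * pi / real n .. \<alpha> + real k * pi / real n}. ray \<theta>)"

definition pizza_inequity :: "real \<Rightarrow> real \<Rightarrow> nat \<Rightarrow> real" where
  "pizza_inequity \<alpha> a n =
     (\<Sum>k\<in>{k\<in>{1..2*n}. even k}. measure lebesgue (slice \<alpha> a n k))
     - (\<Sum>k\<in>{k\<in>{1..2*n}. odd k}. measure lebesgue (slice \<alpha> a n k))"

definition scaled_inequity :: "real \<Rightarrow> real \<Rightarrow> nat \<Rightarrow> real" where
  "scaled_inequity \<alpha> a n = pizza_inequity \<alpha> a n / a"

(* pizza_coeff m j is the coefficient c_{2j}(m) of x^(2j), so the second argument is half the exponent. *)
definition pizza_coeff :: "nat \<Rightarrow> nat \<Rightarrow> real" where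
  "pizza_coeff m j =
     (-1) ^ j * ((1/2) gchoose j)
     * integral {0..2*pi} (\<lambda>\<theta>. cos \<theta> * cos (real m * \<theta>) * sin \<theta> ^ (2*j))"

(* The summation over j = 1, 2, ... is shifted to j = 0, 1, ... *)
definition pizza_series :: "nat \<Rightarrow> real \<Rightarrow> real" where
  "pizza_series m x = (\<Sum>j. pizza_coeff m (Suc j) * x ^ (2 * Suc j))"

definition odd_multiples :: "nat \<Rightarrow> nat set" where
  "odd_multiples n = {m. \<exists>k. odd k \<and> m = k * n}"

end

(*
  In polar coordinates the area of a slice is the integral of r^2 / 2 over its angular interval, and
  r^2 = 1 + a^2 cos 2t + 2 a cos t sqrt (1 - a^2 sin^2 t).  Integrating cos (l t) with alternating
  signs over the 2n intervals gives a geometric sum of roots of unity, so only the frequencies l that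
  are odd multiples of n contribute; since n > 1 is odd, the frequencies 0 and 2 drop out.
  The binomial series of the square root expands the remaining term into the cosine polynomials
  cos t sin^(2j) t of degree 2j + 1, for which the claimed formula is a finite sum.  The j-th of them has
  coefficient at most a^(2j) in absolute value and involves at most 2j + 2 frequencies, so the double
  series over m and j converges absolutely and the two summations may be interchanged.
*)

theory Submission
  imports Defs
begin

section \<open>Areas of sectors in scaled polar coordinates\<close>

text \<open>The radius is measured in units of \<open>R\<close>, so a sector bounded by the curve of
  radius \<open>R\<close> is the image of a rectangle: first coordinate in [0,1], second coordinate
  in the range of angles.\<close>

definition polar_map :: "(real \<Rightarrow> real) \<Rightarrow> real^2 \<Rightarrow> real^2" where
  "polar_map R x = vector [x$1 * R (x$2) * cos (x$2), x$1 * R (x$2) * sin (x$2)]"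

lemma polar_map_has_derivative:
  assumes "\<And>\<theta>. (R has_real_derivative R' \<theta>) (at \<theta>)"
  shows "(polar_map R has_derivative (\<lambda>h. vector
     [h$1 * R (x$2) * cos (x$2) + h$2 * x$1 * (R' (x$2) * cos (x$2) - R (x$2) * sin (x$2)),
      h$1 * R (x$2) * sin (x$2) + h$2 * x$1 * (R' (x$2) * sin (x$2) + R (x$2) * cos (x$2))])) (at x within S)"
proof -
  have nth: "((\<lambda>x::real^2. x $ i) has_derivative (\<lambda>h. h $ i)) (at x within S)" for i
    by (rule bounded_linear_imp_has_derivative) (rule bounded_linear_vec_nth)
  have R: "((\<lambda>x::real^2. R (x $ 2)) has_derivative (\<lambda>h. h $ 2 * R' (x$2))) (at x within S)"
    using has_derivative_compose[OF nth[of 2] assms[of "x$2", THEN has_field_derivative_imp_has_derivative]]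
    by (simp add: mult.commute)
  have "((\<lambda>x. polar_map R x $ i) has_derivative (\<lambda>h. vector
     [h$1 * R (x$2) * cos (x$2) + h$2 * x$1 * (R' (x$2) * cos (x$2) - R (x$2) * sin (x$2)),
      h$1 * R (x$2) * sin (x$2) + h$2 * x$1 * (R' (x$2) * sin (x$2) + R (x$2) * cos (x$2))] $ i))
     (at x within S)" for i :: 2
    using exhaust_2[of i]
    by (auto simp: polar_map_def intro!: derivative_eq_intros nth R simp: algebra_simps)
  then show ?thesis
    by (subst has_derivative_componentwise_within)
       (auto simp: Basis_vec_def inner_axis)
qed

text \<open>The distance of the image from the origin recovers \<open>x$1 * R (x$2)\<close>. Sine
  and cosine then fix the angle up to multiples of 2 pi, and the bound on the interval leaves one
  candidate. The edge \<open>x$1 = 0\<close> is left out because all of it goes to the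
  origin.\<close>

lemma polar_map_inj:
  assumes pos: "\<And>\<theta>. R \<theta> > 0" and "\<gamma> < \<beta> + 2 * pi"
  shows "inj_on (polar_map R) {x. 0 < x$1 \<and> x$2 \<in> {\<beta>..\<gamma>}}"
proof (rule inj_onI, clarsimp)
  fix x y :: "real^2"
  assume x: "0 < x$1" "\<beta> \<le> x$2" "x$2 \<le> \<gamma>" and y: "0 < y$1" "\<beta> \<le> y$2" "y$2 \<le> \<gamma>"
    and eq: "polar_map R x = polar_map R y"
  define r s where "r = x$1 * R (x$2)" and "s = y$1 * R (y$2)"
  have rs: "r > 0" "s > 0" using x y pos by (simp_all add: r_def s_def)
  from eq have c: "r * cos (x$2) = s * cos (y$2)" and d: "r * sin (x$2) = s * sin (y$2)"
    by (simp_all add: polar_map_def vec_eq_iff forall_2 r_def s_def)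
  have "r\<^sup>2 = (r * cos (x$2))\<^sup>2 + (r * sin (x$2))\<^sup>2"
    unfolding power_mult_distrib distrib_left[symmetric] by simp
  also have "\<dots> = s\<^sup>2"
    unfolding c d power_mult_distrib distrib_left[symmetric] by simp
  finally have "r = s" using rs by (simp add: power2_eq_iff_nonneg)
  with c d rs have "cos (x$2) = cos (y$2)" "sin (x$2) = sin (y$2)" by auto
  then obtain k :: int where k: "x$2 = y$2 + 2 * pi * k"
    using sin_cos_eq_iff[of "x$2" "y$2"] by auto
  have "\<bar>2 * pi * k\<bar> < 2 * pi" using k x y assms(2) by linarith
  then have "\<bar>real_of_int k\<bar> < 1" by (simp add: abs_mult)
  then have "k = 0" by linarith
  with k have "x$2 = y$2" by simp
  moreover from this \<open>r = s\<close> have "x$1 = y$1"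
    using pos[of "y$2"] by (simp add: r_def s_def)
  ultimately show "x = y" by (simp add: vec_eq_iff forall_2)
qed

text \<open>Fubini for a product of functions of separate coordinates; the factor \<open>x$1\<close>
  contributes its integral 1/2 over [0,1]. Nonnegativity of \<open>\<phi>\<close> lets the
  factorisation run through \<open>nn_integral\<close>.\<close>

lemma has_integral_mult_rectangle:
  fixes \<phi> :: "real \<Rightarrow> real"
  assumes "continuous_on {\<beta>..\<gamma>} \<phi>" and "\<And>t. \<phi> t \<ge> 0"
  shows "((\<lambda>x::real^2. x$1 * \<phi> (x$2)) has_integral (integral {\<beta>..\<gamma>} \<phi> / 2))
           {x. x$1 \<in> {0..1} \<and> x$2 \<in> {\<beta>..\<gamma>}}"
proof -
  \<comment> \<open>\<open>nn_integral_lborel_prod\<close> takes one factor per basis vector; the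
    indicators cut each coordinate down to its side of the rectangle.\<close>
  let ?f = "\<lambda>b::real^2. if b = axis 1 1 then (\<lambda>s. indicator {0..1} s * s)
              else (\<lambda>t. indicator {\<beta>..\<gamma>} t *\<^sub>R \<phi> t)"
  have ne: "axis 1 1 \<noteq> (axis 2 1 :: real^2)" by (simp add: axis_eq_axis)
  have B: "(Basis :: (real^2) set) = {axis 1 1, axis 2 1}"
    by (auto simp: Basis_vec_def UNIV_2)
  have m2: "(\<lambda>t. indicator {\<beta>..\<gamma>} t *\<^sub>R \<phi> t) \<in> borel_measurable borel"
    using borel_measurable_continuous_on_indicator[OF _ assms(1)] by simp
  have m: "?f b \<in> borel_measurable borel" for b
    using m2 by simp
  have nn: "?f b t \<ge> 0" for b t
    using assms(2) by (simp add: indicator_def)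
  have "((\<lambda>t. if t \<in> {\<beta>..\<gamma>} then \<phi> t else 0) has_integral integral {\<beta>..\<gamma>} \<phi>) UNIV"
    using integrable_integral[OF integrable_continuous_real[OF assms(1)]]
    by (simp only: has_integral_restrict_UNIV)
  then have h2: "((\<lambda>t. indicator {\<beta>..\<gamma>} t *\<^sub>R \<phi> t) has_integral integral {\<beta>..\<gamma>} \<phi>) UNIV"
    by (rule has_integral_eq[rotated]) (simp add: indicator_def)
  then have i2: "(\<integral>\<^sup>+t. ennreal (indicator {\<beta>..\<gamma>} t *\<^sub>R \<phi> t) \<partial>lborel) = ennreal (integral {\<beta>..\<gamma>} \<phi>)"
    using m2 assms(2) by (intro nn_integral_has_integral_lborel) (auto simp: indicator_def)
  have "((\<lambda>s::real. s) has_integral 1/2) {0..1}"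
    using ident_has_integral[of 0 1] by simp
  then have "((\<lambda>t::real. if t \<in> {0..1} then t else 0) has_integral 1/2) UNIV"
    by (simp only: has_integral_restrict_UNIV)
  then have "((\<lambda>s::real. indicator {0..1} s * s) has_integral 1/2) UNIV"
    by (rule has_integral_eq[rotated]) (simp add: indicator_def)
  then have i1: "(\<integral>\<^sup>+s. ennreal (indicator {0..1} s * (s::real)) \<partial>lborel) = ennreal (1/2)"
    by (intro nn_integral_has_integral_lborel) (auto simp: indicator_def)
  have "(\<integral>\<^sup>+x. ennreal (\<Prod>b\<in>Basis. ?f b (x \<bullet> b)) \<partial>lborel)
      = (\<integral>\<^sup>+x. (\<Prod>b\<in>Basis. ennreal (?f b (x \<bullet> b))) \<partial>lborel)"
    by (subst prod_ennreal) (use nn in auto)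
  also have "\<dots> = (\<Prod>b\<in>Basis. (\<integral>\<^sup>+x. ?f b x \<partial>lborel))"
    using m by (intro nn_integral_lborel_prod measurable_compose[OF _ measurable_ennreal]) auto
  also have "\<dots> = ennreal (1/2) * ennreal (integral {\<beta>..\<gamma>} \<phi>)"
    using i1 i2 ne by (simp add: B)
  also have "\<dots> = ennreal (integral {\<beta>..\<gamma>} \<phi> / 2)"
    by (subst ennreal_mult'[symmetric]) (use assms in \<open>auto intro!: integral_nonneg integrable_continuous_real\<close>)
  finally have "((\<lambda>x::real^2. \<Prod>b\<in>Basis. ?f b (x \<bullet> b)) has_integral (integral {\<beta>..\<gamma>} \<phi> / 2)) UNIV"
    by (intro nn_integral_has_integral)
       (use m nn in \<open>auto intro!: prod_nonneg borel_measurable_prod integral_nonneg integrable_continuous_real assms measurable_compose[OF _ m]\<close>)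
  then have "((\<lambda>x::real^2. if x \<in> {x. x$1 \<in> {0..1} \<and> x$2 \<in> {\<beta>..\<gamma>}} then x$1 * \<phi> (x$2) else 0)
      has_integral (integral {\<beta>..\<gamma>} \<phi> / 2)) UNIV"
    by (rule has_integral_eq[rotated]) (use ne in \<open>auto simp: B inner_axis indicator_def\<close>)
  then show ?thesis
    by (simp only: has_integral_restrict_UNIV)
qed

text \<open>Change of variables on \<open>D0\<close>, where \<open>polar_map R\<close> is injective.
  Passing from \<open>D\<close> to \<open>D0\<close> drops an edge of area zero, and the images
  differ at most by the origin.\<close>

lemma measure_polar_sector:
  assumes der: "\<And>\<theta>. (R has_real_derivative R' \<theta>) (at \<theta>)" and pos: "\<And>\<theta>. R \<theta> > 0"
    and "\<gamma> < \<beta> + 2 * pi"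
  shows "measure lebesgue (polar_map R ` {x. x$1 \<in> {0..1} \<and> x$2 \<in> {\<beta>..\<gamma>}})
           = integral {\<beta>..\<gamma>} (\<lambda>\<theta>. (R \<theta>)\<^sup>2) / 2"
proof -
  define D :: "(real^2) set" where "D = {x. x$1 \<in> {0..1} \<and> x$2 \<in> {\<beta>..\<gamma>}}"
  define D0 :: "(real^2) set" where "D0 = {x. x$1 \<in> {0<..1} \<and> x$2 \<in> {\<beta>..\<gamma>}}"
  let ?g' = "\<lambda>x h. vector
     [h$1 * R (x$2) * cos (x$2) + h$2 * x$1 * (R' (x$2) * cos (x$2) - R (x$2) * sin (x$2)),
      h$1 * R (x$2) * sin (x$2) + h$2 * x$1 * (R' (x$2) * sin (x$2) + R (x$2) * cos (x$2))]
      :: real^2"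
  have cont: "continuous_on A (\<lambda>\<theta>. (R \<theta>)\<^sup>2)" for A
    by (intro continuous_intros continuous_at_imp_continuous_on ballI)
       (use der DERIV_isCont in blast)
  have negl: "negligible (D - D0)"
    by (rule negligible_subset[OF negligible_standard_hyperplane_cart[of 1]]) (auto simp: D_def D0_def)
  have jac: "\<bar>det (matrix (?g' x))\<bar> = x$1 * (R (x$2))\<^sup>2" if "x \<in> D0" for x
  proof -
    \<comment> \<open>The terms containing \<open>R'\<close> cancel in the determinant.\<close>
    have "det (matrix (?g' x)) = x$1 * (R (x$2))\<^sup>2 * ((sin (x$2))\<^sup>2 + (cos (x$2))\<^sup>2)"
      by (simp add: det_2 matrix_def axis_def power2_eq_square algebra_simps
               del: sin_cos_squared_add sin_cos_squared_add3)
    then show ?thesis using that by (simp add: D0_def)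
  qed
  have "((\<lambda>x. x$1 * (R (x$2))\<^sup>2) has_integral (integral {\<beta>..\<gamma>} (\<lambda>\<theta>. (R \<theta>)\<^sup>2) / 2)) D"
    unfolding D_def by (rule has_integral_mult_rectangle[OF cont]) simp
  then have "((\<lambda>x. x$1 * (R (x$2))\<^sup>2) has_integral (integral {\<beta>..\<gamma>} (\<lambda>\<theta>. (R \<theta>)\<^sup>2) / 2)) D0"
    by (rule has_integral_spike_set_eq[THEN iffD1, rotated 2])
       (rule negligible_subset[OF negl]; auto simp: D_def D0_def)+
  then have "((\<lambda>x. \<bar>det (matrix (?g' x))\<bar>) has_integral (integral {\<beta>..\<gamma>} (\<lambda>\<theta>. (R \<theta>)\<^sup>2) / 2)) D0"
    by (rule has_integral_eq[rotated]) (simp add: jac)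
  moreover have "D0 \<in> sets lebesgue"
  proof -
    have "D0 = {x. 0 < x$1} \<inter> cbox (vector [0, \<beta>]) (vector [1, \<gamma>])"
      by (auto simp: D0_def mem_box_cart forall_2)
    moreover have "open {x::real^2. 0 < x$1}"
      by (intro open_Collect_less continuous_intros)
    ultimately show ?thesis by (auto simp: borel_open)
  qed
  moreover have "inj_on (polar_map R) D0"
    by (rule inj_on_subset[OF polar_map_inj[OF pos assms(3)]]) (auto simp: D0_def)
  ultimately have "polar_map R ` D0 \<in> lmeasurable \<and> measure lebesgue (polar_map R ` D0)
      = integral {\<beta>..\<gamma>} (\<lambda>\<theta>. (R \<theta>)\<^sup>2) / 2"
    using has_measure_differentiable_image[OF _ polar_map_has_derivative[OF der]] by blast
  moreover have "measure lebesgue (polar_map R ` D) = measure lebesgue (polar_map R ` D0)"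
  proof (rule measure_negligible_symdiff)
    show "polar_map R ` D0 \<in> lmeasurable" using calculation by blast
    have "x \<in> D - D0 \<Longrightarrow> polar_map R x = 0" for x
      by (auto simp: D_def D0_def polar_map_def vec_eq_iff forall_2)
    then have "polar_map R ` D0 - polar_map R ` D \<union> (polar_map R ` D - polar_map R ` D0) \<subseteq> {0}"
      by (auto simp: D_def D0_def image_iff)
    then show "negligible (polar_map R ` D0 - polar_map R ` D \<union> (polar_map R ` D - polar_map R ` D0))"
      by (rule negligible_subset[rotated]) simp
  qed
  ultimately show ?thesis by (simp add: D_def)
qed

section \<open>The pizza in polar coordinates\<close>

text \<open>The larger root r of r^2 - 2 a r cos \<theta> + a^2 = 1, which is the equation of the
  boundary circle along the ray at angle \<theta>.\<close>

definition pizza_radius :: "real \<Rightarrow> real \<Rightarrow> real" where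
  "pizza_radius a \<theta> = a * cos \<theta> + sqrt (1 - a\<^sup>2 * (sin \<theta>)\<^sup>2)"

lemma square_mult_sin_square_le:
  fixes a \<theta> :: real
  shows "a\<^sup>2 * (sin \<theta>)\<^sup>2 \<le> a\<^sup>2"
  by (intro mult_left_le) (auto simp: abs_square_le_1)

text \<open>After squaring, this reads a^2 - a^2 sin^2 \<theta> < 1 - a^2 sin^2 \<theta>.
  Geometrically, the origin is an interior point, so the line through it at angle \<theta> meets the
  circle once on each side.\<close>

lemma abs_mult_cos_less:
  fixes a \<theta> :: real
  assumes "0 < a" "a < 1"
  shows "\<bar>a * cos \<theta>\<bar> < sqrt (1 - a\<^sup>2 * (sin \<theta>)\<^sup>2)"
proof (rule real_less_rsqrt)
  have "\<bar>a * cos \<theta>\<bar>\<^sup>2 = a\<^sup>2 - a\<^sup>2 * (sin \<theta>)\<^sup>2"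
    by (simp add: power_mult_distrib cos_squared_eq algebra_simps)
  then show "\<bar>a * cos \<theta>\<bar>\<^sup>2 < 1 - a\<^sup>2 * (sin \<theta>)\<^sup>2"
    using assms by (simp add: power_less_one_iff abs_square_less_1)
qed

lemma pizza_radius_pos: "0 < a \<Longrightarrow> a < 1 \<Longrightarrow> 0 < pizza_radius a \<theta>"
  using abs_mult_cos_less[of a \<theta>] by (simp add: pizza_radius_def)

lemma one_minus_mult_sin_square_pos:
  fixes a \<theta> :: real
  assumes "0 < a" "a < 1" shows "0 < 1 - a\<^sup>2 * (sin \<theta>)\<^sup>2"
  using assms square_mult_sin_square_le[of a \<theta>] by (smt (verit) power_less_one_iff zero_less_numeral)

text \<open>Completing the square turns membership into a bound on the absolute value of r - a cos
  \<theta>. The lower half of that bound holds for every r >= 0 by \<open>abs_mult_cos_less\<close>,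
  so only the upper half remains.\<close>

lemma in_pizza_polar_iff:
  assumes "0 < a" "a < 1" "0 \<le> r" "z $ 1 = r * cos \<theta>" "z $ 2 = r * sin \<theta>"
  shows "z \<in> pizza a \<longleftrightarrow> r \<le> pizza_radius a \<theta>"
proof -
  let ?S = "sqrt (1 - a\<^sup>2 * (sin \<theta>)\<^sup>2)"
  have S: "?S\<^sup>2 = 1 - a\<^sup>2 + (a * cos \<theta>)\<^sup>2"
    using one_minus_mult_sin_square_pos[OF assms(1,2), of \<theta>] by (simp add: power_mult_distrib cos_squared_eq algebra_simps)
  have abs_S: "\<bar>?S\<bar> = ?S" using abs_mult_cos_less[OF assms(1,2), of \<theta>] by linarith
  have "(r * cos \<theta> - a)\<^sup>2 + (r * sin \<theta>)\<^sup>2 = r\<^sup>2 * ((sin \<theta>)\<^sup>2 + (cos \<theta>)\<^sup>2) - 2 * a * r * cos \<theta> + a\<^sup>2"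
    by (simp add: power2_eq_square algebra_simps del: sin_cos_squared_add sin_cos_squared_add3)
  then have "(r * cos \<theta> - a)\<^sup>2 + (r * sin \<theta>)\<^sup>2 = (r - a * cos \<theta>)\<^sup>2 + a\<^sup>2 - (a * cos \<theta>)\<^sup>2"
    by (simp add: power2_diff)
  then have "z \<in> pizza a \<longleftrightarrow> (r - a * cos \<theta>)\<^sup>2 \<le> ?S\<^sup>2"
    unfolding S by (auto simp: pizza_def assms(4,5))
  also have "\<dots> \<longleftrightarrow> \<bar>r - a * cos \<theta>\<bar> \<le> ?S"
    by (simp only: abs_le_square_iff[symmetric] abs_S)
  also have "\<dots> \<longleftrightarrow> r \<le> pizza_radius a \<theta>"
    using abs_mult_cos_less[OF assms(1,2), of \<theta>] assms(3) by (auto simp: pizza_radius_def)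
  finally show ?thesis .
qed

text \<open>On each ray \<open>in_pizza_polar_iff\<close> leaves exactly the distances from 0 to
  \<open>pizza_radius a \<theta>\<close>; dividing by this positive radius yields the first
  coordinate of a preimage.\<close>

lemma pizza_sector_eq:
  assumes "0 < a" "a < 1"
  shows "pizza a \<inter> (\<Union>\<theta>\<in>I. ray \<theta>) = polar_map (pizza_radius a) ` {x. x$1 \<in> {0..1} \<and> x$2 \<in> I}"
proof (intro equalityI subsetI)
  fix z assume "z \<in> pizza a \<inter> (\<Union>\<theta>\<in>I. ray \<theta>)"
  then obtain \<theta> r where *: "z \<in> pizza a" "\<theta> \<in> I" "r \<ge> 0" "z $ 1 = r * cos \<theta>" "z $ 2 = r * sin \<theta>"
    by (auto simp: ray_def)
  let ?R = "pizza_radius a \<theta>"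
  have "z = polar_map (pizza_radius a) (vector [r / ?R, \<theta>])"
    using * pizza_radius_pos[OF assms, of \<theta>] by (simp add: polar_map_def vec_eq_iff forall_2)
  moreover have "r / ?R \<in> {0..1}"
    using in_pizza_polar_iff[OF assms *(3-5)] * pizza_radius_pos[OF assms, of \<theta>] by simp
  ultimately show "z \<in> polar_map (pizza_radius a) ` {x. x$1 \<in> {0..1} \<and> x$2 \<in> I}"
    using * by force
next
  fix z assume "z \<in> polar_map (pizza_radius a) ` {x. x$1 \<in> {0..1} \<and> x$2 \<in> I}"
  then obtain x where *: "x$1 \<in> {0..1}" "x$2 \<in> I" "z = polar_map (pizza_radius a) x" by auto
  let ?r = "x$1 * pizza_radius a (x$2)"
  have r: "0 \<le> ?r" "?r \<le> pizza_radius a (x$2)"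
    using * pizza_radius_pos[OF assms, of "x$2"] by (auto intro: mult_left_le_one_le)
  have z: "z $ 1 = ?r * cos (x$2)" "z $ 2 = ?r * sin (x$2)"
    using * by (simp_all add: polar_map_def)
  have "z \<in> ray (x$2)" using r z by (auto simp: ray_def)
  then show "z \<in> pizza a \<inter> (\<Union>\<theta>\<in>I. ray \<theta>)"
    using in_pizza_polar_iff[OF assms r(1) z] r * by auto
qed

lemma measure_slice:
  assumes "0 < a" "a < 1" "n > 0"
  shows "measure lebesgue (slice \<alpha> a n k)
     = integral {\<alpha> + (real k - 1) * pi / real n .. \<alpha> + real k * pi / real n} (\<lambda>\<theta>. (pizza_radius a \<theta>)\<^sup>2) / 2"
proof -
  have "(pizza_radius a has_real_derivative
      - (a * sin \<theta>) - a\<^sup>2 * sin \<theta> * cos \<theta> / sqrt (1 - a\<^sup>2 * (sin \<theta>)\<^sup>2)) (at \<theta>)" for \<theta>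
    unfolding pizza_radius_def[abs_def] using one_minus_mult_sin_square_pos[OF assms(1,2), of \<theta>]
    by (auto intro!: derivative_eq_intros simp: field_simps power2_eq_square)
  \<comment> \<open>A slice spans the angle pi / n, which is below the full turn, as injectivity of
    the polar map demands.\<close>
  moreover have "\<alpha> + real k * pi / real n < \<alpha> + (real k - 1) * pi / real n + 2 * pi"
    using assms(3) by (simp add: field_simps)
  ultimately show ?thesis
    unfolding slice_def pizza_sector_eq[OF assms(1,2)]
    by (intro measure_polar_sector pizza_radius_pos[OF assms(1,2)])
qed

section \<open>Alternating integrals over the slices\<close>

text \<open>Even slices count positively and odd ones negatively, so the squared radius gives twice
  the inequity. Linearity in \<open>F\<close> allows evaluation frequency by frequency.\<close>

definition alternating_integral :: "real \<Rightarrow> nat \<Rightarrow> (real \<Rightarrow> real) \<Rightarrow> real" where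
  "alternating_integral \<alpha> n F =
     (\<Sum>k\<in>{1..2*n}. (-1) ^ k * integral {\<alpha> + (real k - 1) * pi / real n .. \<alpha> + real k * pi / real n} F)"

lemma alternating_integral_add:
  assumes "continuous_on UNIV F" "continuous_on UNIV G"
  shows "alternating_integral \<alpha> n (\<lambda>\<theta>. F \<theta> + G \<theta>) = alternating_integral \<alpha> n F + alternating_integral \<alpha> n G"
proof -
  have "F integrable_on {p..q}" "G integrable_on {p..q}" for p q :: real
    using assms by (auto intro: integrable_continuous_real continuous_on_subset)
  then show ?thesis
    by (simp add: alternating_integral_def Henstock_Kurzweil_Integration.integral_add distrib_left sum.distrib)
qed

lemma alternating_integral_mult: "alternating_integral \<alpha> n (\<lambda>\<theta>. c * F \<theta>) = c * alternating_integral \<alpha> n F"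
  by (simp add: alternating_integral_def sum_distrib_left mult_ac)

text \<open>The equation says that l / n is an odd integer; its real part, a cosine equal to -1,
  already forces this.\<close>

lemma cis_eq_minus_1_iff_odd_multiple:
  assumes "n > 0"
  shows "cis (real l * pi / real n) = -1 \<longleftrightarrow> l \<in> odd_multiples n"
proof
  assume "cis (real l * pi / real n) = -1"
  then have "cos (real l * pi / real n) = -1" by (simp add: complex_eq_iff)
  then obtain z :: int where "real l * pi / real n = (2*z + 1) * pi" by (auto simp: cos_eq_minus1)
  then have "real l * pi / real n = real_of_int (2*z + 1) * pi" by simp
  then have "pi * real l = pi * (real_of_int (2*z + 1) * real n)" using assms by (simp add: field_simps)
  then have "real l = real_of_int (2*z + 1) * real n" by (simp only: mult_cancel_left pi_neq_zero) simp
  then have "real_of_int (int l) = real_of_int ((2*z + 1) * int n)" by simp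
  then have l: "int l = (2*z + 1) * int n" by (simp only: of_int_eq_iff)
  \<comment> \<open>The odd factor comes as an integer; its sign has to be settled before it can
    serve as a natural number in \<open>odd_multiples\<close>.\<close>
  then have "0 \<le> (2*z + 1) * int n" by (metis of_nat_0_le_iff)
  then have "2*z + 1 \<ge> 0" using assms by (simp add: zero_le_mult_iff)
  then have "int l = int (nat (2*z + 1) * n)" using l by simp
  then have "l = nat (2*z+1) * n" by (simp only: of_nat_eq_iff)
  moreover have "odd (nat (2*z+1))" using \<open>2*z + 1 \<ge> 0\<close> by (simp add: even_nat_iff)
  ultimately show "l \<in> odd_multiples n" unfolding odd_multiples_def by blast
next
  assume "l \<in> odd_multiples n"
  then obtain k where "odd k" "l = k * n" by (auto simp: odd_multiples_def)
  then show "cis (real l * pi / real n) = -1"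
    using assms by (simp add: Complex.DeMoivre[symmetric])
qed

text \<open>With \<omega> = cis (l pi / n), the antiderivative sin (l \<theta>) / l turns the sum
  into 1 / l times the imaginary part of cis (l \<alpha>) (1 - \<omega>) times the geometric sum of
  the first 2n powers of -\<omega>. As (-\<omega>)^(2n) = 1, that sum vanishes unless \<omega> = -1;
  then it is 2n and 1 - \<omega> = 2, whence the factor 4n.\<close>

lemma alternating_integral_cos:
  assumes "n > 0"
  shows "alternating_integral \<alpha> n (\<lambda>\<theta>. cos (real l * \<theta>))
     = (if l \<in> odd_multiples n then 4 * real n / real l * sin (real l * \<alpha>) else 0)"
proof -
  define x where "x k = \<alpha> + real k * pi / real n" for k :: nat
  have x_le: "x k \<le> x (Suc k)" for k by (simp add: x_def divide_right_mono)
  have "alternating_integral \<alpha> n (\<lambda>\<theta>. cos (real l * \<theta>))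
     = (\<Sum>k\<in>Suc ` {..<2*n}. (-1) ^ k * integral {\<alpha> + (real k - 1) * pi / real n .. \<alpha> + real k * pi / real n} (\<lambda>\<theta>. cos (real l * \<theta>)))"
    unfolding alternating_integral_def by (intro sum.cong) (auto simp: image_Suc_lessThan)
  also have "\<dots> = (\<Sum>k<2*n. (-1) ^ Suc k * integral {x k .. x (Suc k)} (\<lambda>\<theta>. cos (real l * \<theta>)))"
    by (subst sum.reindex) (simp_all add: x_def)
  finally have eq: "alternating_integral \<alpha> n (\<lambda>\<theta>. cos (real l * \<theta>)) = \<dots>" .
  show ?thesis
  \<comment> \<open>The antiderivative divides by l, so the constant function is treated apart: its
    integrals all equal pi / n and the 2n signs cancel.\<close>
  proof (cases "l = 0")
    case True
    have "integral {x k .. x (Suc k)} (\<lambda>\<theta>. cos (real l * \<theta>)) = pi / real n" for k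
      using x_le[of k] True by (simp add: x_def add_divide_distrib distrib_right)
    moreover have "(\<Sum>k<2*n. (-1::real) ^ Suc k) = 0"
      using sum_gp_strict[of "-1::real" "2*n"] by (simp add: sum_negf)
    ultimately have "alternating_integral \<alpha> n (\<lambda>\<theta>. cos (real l * \<theta>)) = 0"
      unfolding eq by (simp add: sum_negf flip: sum_divide_distrib sum_distrib_right)
    then show ?thesis using True by simp
  next
    case False
    define \<omega> where "\<omega> = cis (real l * pi / real n)"
    have "((\<lambda>\<theta>. cos (real l * \<theta>)) has_integral sin (real l * x (Suc k)) / real l - sin (real l * x k) / real l) {x k..x (Suc k)}" for k
      using False
      by (intro fundamental_theorem_of_calculus x_le)
         (auto intro!: derivative_eq_intros simp flip: has_real_derivative_iff_has_vector_derivative)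
    then have "integral {x k .. x (Suc k)} (\<lambda>\<theta>. cos (real l * \<theta>)) = (sin (real l * x (Suc k)) - sin (real l * x k)) / real l" for k
      by (simp add: integral_unique diff_divide_distrib)
    then have "alternating_integral \<alpha> n (\<lambda>\<theta>. cos (real l * \<theta>))
      = (\<Sum>k<2*n. (-1) ^ Suc k * (sin (real l * x (Suc k)) - sin (real l * x k))) / real l"
      by (simp add: eq sum_divide_distrib)
    also have "(\<Sum>k<2*n. (-1) ^ Suc k * (sin (real l * x (Suc k)) - sin (real l * x k)))
       = Im (\<Sum>k<2*n. of_real ((-1) ^ Suc k) * (cis (real l * x (Suc k)) - cis (real l * x k)))"
      unfolding Im_sum by (intro sum.cong refl) (simp del: of_real_power)
    also have "(\<Sum>k<2*n. of_real ((-1) ^ Suc k) * (cis (real l * x (Suc k)) - cis (real l * x k)))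
       = cis (real l * \<alpha>) * (1 - \<omega>) * (\<Sum>k<2*n. (- \<omega>) ^ k)"
    proof -
      have cis_x: "cis (real l * x k) = cis (real l * \<alpha>) * \<omega> ^ k" for k
        by (simp add: \<omega>_def x_def Complex.DeMoivre cis_mult algebra_simps)
      have "of_real ((-1) ^ Suc k) * (cis (real l * x (Suc k)) - cis (real l * x k))
          = cis (real l * \<alpha>) * (1 - \<omega>) * (- \<omega>) ^ k" for k
        unfolding cis_x power_minus[of \<omega>] by (simp add: algebra_simps)
      then show ?thesis by (simp add: sum_distrib_left)
    qed
    also have "\<dots> = (if l \<in> odd_multiples n then 4 * real n * cis (real l * \<alpha>) else 0)"
    proof (cases "l \<in> odd_multiples n")
      case True
      then have "\<omega> = -1" using cis_eq_minus_1_iff_odd_multiple[OF assms] by (simp add: \<omega>_def)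
      then show ?thesis using True by simp
    next
      case F: False
      then have "- \<omega> \<noteq> 1" using cis_eq_minus_1_iff_odd_multiple[OF assms]
        by (metis \<omega>_def minus_minus)
      moreover have "(- \<omega>) ^ (2*n) = 1"
      proof -
        have "\<omega> ^ (2*n) = cis (2 * pi * real l)"
          using assms by (simp add: \<omega>_def Complex.DeMoivre mult_ac)
        also have "\<dots> = 1" by (rule cis_multiple_2pi) simp
        finally show ?thesis by simp
      qed
      ultimately show ?thesis using F by (simp add: sum_gp_strict)
    qed
    finally show ?thesis by simp
  qed
qed

section \<open>Cosine polynomials and orthogonality\<close>

text \<open>The linear span of the cosines of frequency at most N. Generating it inductively lets
  linear statements be proved on single cosines, without explicit coefficients.\<close>

inductive_set cosine_polys :: "nat \<Rightarrow> (real \<Rightarrow> real) set" for N where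
  cos: "l \<le> N \<Longrightarrow> (\<lambda>\<theta>. cos (real l * \<theta>)) \<in> cosine_polys N"
| add: "F \<in> cosine_polys N \<Longrightarrow> G \<in> cosine_polys N \<Longrightarrow> (\<lambda>\<theta>. F \<theta> + G \<theta>) \<in> cosine_polys N"
| mult: "F \<in> cosine_polys N \<Longrightarrow> (\<lambda>\<theta>. c * F \<theta>) \<in> cosine_polys N"

text \<open>Since sin^2 \<theta> = (1 - cos 2\<theta>) / 2, the product-to-sum formula sends
  frequency l to l, l + 2 and the distance of l from 2.\<close>

lemma cosine_polys_mult_sin_square:
  assumes "F \<in> cosine_polys N"
  shows "(\<lambda>\<theta>. F \<theta> * (sin \<theta>)\<^sup>2) \<in> cosine_polys (N + 2)"
  using assms
proof induction
  case (cos l)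
  \<comment> \<open>The witness is the absolute difference of l and 2: frequencies are natural
    numbers, and cosine is even.\<close>
  obtain l' where l': "l' \<le> N + 2" "\<And>\<theta>. cos (real l' * \<theta>) = cos (real l * \<theta> - 2 * \<theta>)"
  proof (cases "l \<ge> 2")
    case True
    then show ?thesis using that[of "l - 2"] cos by (simp add: of_nat_diff algebra_simps)
  next
    case False
    have "cos (real (2 - l) * \<theta>) = cos (real l * \<theta> - 2 * \<theta>)" for \<theta>
    proof -
      have "real (2 - l) * \<theta> = - (real l * \<theta> - 2 * \<theta>)" using False by (simp add: of_nat_diff algebra_simps)
      then show ?thesis by (simp only: cos_minus)
    qed
    then show ?thesis using that[of "2 - l"] by simp
  qed
  have "cos (real l * \<theta>) * (sin \<theta>)\<^sup>2
      = 1/2 * cos (real l * \<theta>) + (- 1/4 * cos (real (l + 2) * \<theta>) + - 1/4 * cos (real l' * \<theta>))" for \<theta>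
  proof -
    have "cos (real (l + 2) * \<theta>) + cos (real l' * \<theta>) = cos (real l * \<theta> + 2 * \<theta>) + cos (real l * \<theta> - 2 * \<theta>)"
      by (simp add: l' distrib_right add.commute)
    also have "\<dots> = 2 * (cos (real l * \<theta>) * cos (2 * \<theta>))"
      by (simp only: cos_add cos_diff)
    finally have "cos (real (l + 2) * \<theta>) + cos (real l' * \<theta>)
        = 2 * cos (real l * \<theta>) - 4 * (cos (real l * \<theta>) * (sin \<theta>)\<^sup>2)"
      by (simp only: cos_double_sin) (simp add: right_diff_distrib)
    then show ?thesis by linarith
  qed
  moreover have "(\<lambda>\<theta>. 1/2 * cos (real l * \<theta>) + (- 1/4 * cos (real (l + 2) * \<theta>) + - 1/4 * cos (real l' * \<theta>)))
     \<in> cosine_polys (N + 2)"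
    using cos l' by (intro cosine_polys.intros) auto
  ultimately show ?case by simp
next
  case (add F G)
  then show ?case by (simp add: distrib_right cosine_polys.add)
next
  case (mult F c)
  then show ?case by (simp add: mult.assoc cosine_polys.mult)
qed

lemma cos_mult_sin_power_in_cosine_polys:
  "(\<lambda>\<theta>. cos \<theta> * sin \<theta> ^ (2*j)) \<in> cosine_polys (2*j + 1)"
proof (induction j)
  case 0
  show ?case using cosine_polys.cos[of 1 1] by simp
next
  case (Suc j)
  from cosine_polys_mult_sin_square[OF this] show ?case
    by (simp add: power2_eq_square mult_ac)
qed

lemma integral_cos_full_period:
  assumes "k \<in> \<int>" "k \<noteq> 0"
  shows "((\<lambda>\<theta>. cos (k * \<theta>)) has_integral 0) {0..2*pi}"
proof -
  have "((\<lambda>\<theta>. cos (k * \<theta>)) has_integral sin (k * (2*pi)) / k - sin (k * 0) / k) {0..2*pi}"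
    using assms by (intro fundamental_theorem_of_calculus)
         (auto intro!: derivative_eq_intros simp flip: has_real_derivative_iff_has_vector_derivative)
  moreover have "sin (k * (2*pi)) = 0"
    using assms(1) by (subst mult.commute) (auto elim!: Ints_cases simp: sin_integer_2pi)
  ultimately show ?thesis by simp
qed

text \<open>Product-to-sum again. Positivity of m makes the frequency l + m nonzero and excludes l =
  m = 0, where the integral would be 2 pi.\<close>

lemma integral_cos_mult_cos:
  assumes "m > 0"
  shows "integral {0..2*pi} (\<lambda>\<theta>. cos (real l * \<theta>) * cos (real m * \<theta>)) = (if l = m then pi else 0)"
proof -
  have eq: "cos (real l * \<theta>) * cos (real m * \<theta>)
      = 1/2 * cos ((real l - real m) * \<theta>) + 1/2 * cos ((real l + real m) * \<theta>)" for \<theta>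
    by (simp add: left_diff_distrib distrib_right cos_add cos_diff add_divide_distrib diff_divide_distrib)
  have p: "((\<lambda>\<theta>. cos ((real l + real m) * \<theta>)) has_integral 0) {0..2*pi}"
    using assms by (intro integral_cos_full_period) auto
  have d: "((\<lambda>\<theta>. cos ((real l - real m) * \<theta>)) has_integral (if l = m then 2*pi else 0)) {0..2*pi}"
  proof (cases "l = m")
    case True
    then show ?thesis using has_integral_const_real[of "1::real" 0 "2*pi"] by simp
  next
    case False
    then show ?thesis using integral_cos_full_period[of "real l - real m"] by auto
  qed
  show ?thesis
    unfolding eq using has_integral_add[OF has_integral_mult_right[OF d, of "1/2"] has_integral_mult_right[OF p, of "1/2"]]
    by (auto intro!: integral_unique)
qed

lemma cosine_polys_continuous: "F \<in> cosine_polys N \<Longrightarrow> continuous_on A F"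
  by (induction rule: cosine_polys.induct) (auto intro!: continuous_intros)

lemma integral_mult_cos_add:
  assumes "F \<in> cosine_polys N" "G \<in> cosine_polys N"
  shows "integral {0..2*pi} (\<lambda>\<theta>. (F \<theta> + G \<theta>) * cos (real m * \<theta>))
    = integral {0..2*pi} (\<lambda>\<theta>. F \<theta> * cos (real m * \<theta>)) + integral {0..2*pi} (\<lambda>\<theta>. G \<theta> * cos (real m * \<theta>))"
  unfolding distrib_right
  by (intro Henstock_Kurzweil_Integration.integral_add integrable_continuous_real continuous_intros
        cosine_polys_continuous[OF assms(1)] cosine_polys_continuous[OF assms(2)])

text \<open>Every frequency in F is below m. Applied to the terms of the binomial expansion, this
  makes the coefficients with 2j + 1 < m vanish.\<close>

lemma cosine_polys_orthogonal:
  assumes "F \<in> cosine_polys N" "N < m"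
  shows "integral {0..2*pi} (\<lambda>\<theta>. F \<theta> * cos (real m * \<theta>)) = 0"
  using assms
  by (induction rule: cosine_polys.induct) (auto simp: integral_cos_mult_cos integral_mult_cos_add mult.assoc)

text \<open>Both sides are linear in F, so a single cosine of frequency l suffices. By orthogonality
  only m = l survives on the right, where the integral pi cancels the pi in the denominator.\<close>

lemma alternating_integral_cosine_poly:
  assumes "F \<in> cosine_polys N" "n > 0"
  shows "alternating_integral \<alpha> n F = (\<Sum>m\<in>odd_multiples n \<inter> {..N}.
     4 * real n / (pi * real m) * sin (real m * \<alpha>) * integral {0..2*pi} (\<lambda>\<theta>. F \<theta> * cos (real m * \<theta>)))"
  using assms
proof (induction rule: cosine_polys.induct)
  case (cos l)
  have "m > 0" if "m \<in> odd_multiples n" for m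
    using that \<open>n > 0\<close> by (auto simp: odd_multiples_def intro!: Nat.gr0I)
  then have "(\<Sum>m\<in>odd_multiples n \<inter> {..N}.
     4 * real n / (pi * real m) * sin (real m * \<alpha>) * integral {0..2*pi} (\<lambda>\<theta>. cos (real l * \<theta>) * cos (real m * \<theta>)))
     = (\<Sum>m\<in>odd_multiples n \<inter> {..N}. if l = m then 4 * real n / real m * sin (real m * \<alpha>) else 0)"
    by (intro sum.cong) (auto simp: integral_cos_mult_cos)
  also have "\<dots> = (if l \<in> odd_multiples n then 4 * real n / real l * sin (real l * \<alpha>) else 0)"
    using cos by (subst sum.delta') auto
  finally show ?case using cos by (simp add: alternating_integral_cos)
next
  case (add F G)
  then show ?case
    by (simp add: alternating_integral_add cosine_polys_continuous integral_mult_cos_add distrib_left sum.distrib)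
next
  case (mult F c)
  have eq: "integral {0..2*pi} (\<lambda>\<theta>. c * F \<theta> * cos (real m * \<theta>))
      = c * integral {0..2*pi} (\<lambda>\<theta>. F \<theta> * cos (real m * \<theta>))" for m
    by (simp add: mult.assoc)
  show ?case
    unfolding eq alternating_integral_mult mult.IH[OF mult.prems] by (simp add: sum_distrib_left mult_ac)
qed

section \<open>Binomial expansion of the square root term\<close>

text \<open>Consecutive coefficients have ratio (1/2 - j) / (j + 1), of absolute value at most
  1.\<close>

lemma abs_gbinomial_half_le: "\<bar>(1/2 :: real) gchoose j\<bar> \<le> 1"
proof (induction j)
  case (Suc j)
  have "((1/2 :: real) gchoose Suc j) = ((1/2) gchoose j) * ((1/2 - real j) / real (Suc j))"
    using gbinomial_mult_1[of "1/2::real" j] by (simp add: field_simps)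
  then have "\<bar>((1/2 :: real) gchoose Suc j)\<bar> = \<bar>(1/2 :: real) gchoose j\<bar> * (\<bar>1/2 - real j\<bar> / real (Suc j))"
    by (simp add: abs_mult)
  also have "\<dots> \<le> 1 * 1"
    using Suc by (intro mult_mono) auto
  finally show ?case by simp
qed simp

lemma sqrt_one_minus_sums:
  fixes x :: real
  assumes "\<bar>x\<bar> < 1"
  shows "(\<lambda>j. (-1) ^ j * ((1/2) gchoose j) * x ^ j) sums sqrt (1 - x)"
proof -
  have "(\<lambda>j. ((1/2) gchoose j) * (- x) ^ j) sums (1 + - x) powr (1/2)"
    using assms by (intro gen_binomial_real) simp
  then show ?thesis
    using assms by (simp add: powr_half_sqrt power_minus[of x] mult_ac)
qed

text \<open>The j-th binomial term of cos \<theta> sqrt (1 - a^2 sin^2 \<theta>), with its scalar in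
  front so that \<open>cosine_polys.mult\<close> applies.\<close>

definition radial_term :: "real \<Rightarrow> nat \<Rightarrow> real \<Rightarrow> real" where
  "radial_term a j \<theta> = ((-1) ^ j * ((1/2) gchoose j) * a ^ (2*j)) * (cos \<theta> * sin \<theta> ^ (2*j))"

lemma abs_radial_term_le:
  assumes "0 < a"
  shows "\<bar>radial_term a j \<theta>\<bar> \<le> (a\<^sup>2) ^ j"
proof -
  have "\<bar>radial_term a j \<theta>\<bar> = (\<bar>(1/2) gchoose j\<bar> * \<bar>cos \<theta>\<bar> * \<bar>sin \<theta>\<bar> ^ (2*j)) * a ^ (2*j)"
    using assms by (simp add: radial_term_def abs_mult power_abs)
  also have "\<dots> \<le> (1 * 1 * 1) * a ^ (2*j)"
    using assms abs_gbinomial_half_le[of j] by (intro mult_mono power_le_one) (auto intro: power_le_one)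
  finally show ?thesis by (simp add: power_mult)
qed

lemma radial_term_in_cosine_polys: "radial_term a j \<in> cosine_polys (2*j + 1)"
  unfolding radial_term_def[abs_def] by (intro cosine_polys.mult cos_mult_sin_power_in_cosine_polys)

text \<open>Identifies the integrals in \<open>alternating_integral_cosine_poly\<close> with the
  terms of the power series in the claim.\<close>

lemma radial_term_coeff:
  "integral {0..2*pi} (\<lambda>\<theta>. radial_term a j \<theta> * cos (real m * \<theta>)) = pizza_coeff m j * a ^ (2*j)"
proof -
  have "(\<lambda>\<theta>. radial_term a j \<theta> * cos (real m * \<theta>))
     = (\<lambda>\<theta>. ((-1) ^ j * ((1/2) gchoose j) * a ^ (2*j)) * (cos \<theta> * cos (real m * \<theta>) * sin \<theta> ^ (2*j)))"
    by (simp add: radial_term_def mult_ac)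
  then show ?thesis by (simp add: pizza_coeff_def)
qed

text \<open>The pointwise bound times the length 2 pi of the interval. It is uniform in m, which the
  double series relies on.\<close>

lemma abs_pizza_coeff_le:
  assumes "0 < a"
  shows "\<bar>pizza_coeff m j * a ^ (2*j)\<bar> \<le> 2 * pi * (a\<^sup>2) ^ j"
proof -
  have "norm (integral {0..2*pi} (\<lambda>\<theta>. radial_term a j \<theta> * cos (real m * \<theta>))) \<le> (a\<^sup>2) ^ j * (2*pi - 0)"
  proof (rule integral_bound)
    fix \<theta>
    have "\<bar>radial_term a j \<theta>\<bar> * \<bar>cos (real m * \<theta>)\<bar> \<le> (a\<^sup>2) ^ j * 1"
      by (intro mult_mono abs_radial_term_le assms) auto
    then show "norm (radial_term a j \<theta> * cos (real m * \<theta>)) \<le> (a\<^sup>2) ^ j" by (simp add: abs_mult)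
  qed (auto intro!: continuous_intros cosine_polys_continuous[OF radial_term_in_cosine_polys])
  then show ?thesis
    unfolding radial_term_coeff by (simp add: mult.commute[of "2*pi"])
qed

lemma pizza_coeff_summable:
  assumes "0 < a" "a < 1"
  shows "summable (\<lambda>j. norm (pizza_coeff m j * a ^ (2*j)))"
proof (rule summable_comparison_test')
  show "summable (\<lambda>j. 2 * pi * (a\<^sup>2) ^ j)"
    using assms by (intro summable_mult summable_geometric) (simp add: abs_square_less_1)
  show "norm (norm (pizza_coeff m j * a ^ (2*j))) \<le> 2 * pi * (a\<^sup>2) ^ j" for j
    using abs_pizza_coeff_le[OF assms(1)] by simp
qed

lemma radial_terms_sums:
  assumes "0 < a" "a < 1"
  shows "(\<lambda>j. radial_term a j \<theta>) sums (cos \<theta> * sqrt (1 - a\<^sup>2 * (sin \<theta>)\<^sup>2))"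
proof -
  have "\<bar>a\<^sup>2 * (sin \<theta>)\<^sup>2\<bar> < 1" using one_minus_mult_sin_square_pos[OF assms, of \<theta>] by simp
  from sums_mult[OF sqrt_one_minus_sums[OF this], of "cos \<theta>"] show ?thesis
    unfolding radial_term_def power_mult_distrib power_mult by (simp only: mult_ac)
qed

text \<open>The geometric majorant (a^2)^j does not depend on \<theta>, so the Weierstrass test
  gives uniform convergence and hence termwise integration.\<close>

lemma integral_radial_terms_sums:
  assumes "0 < a" "a < 1"
  shows "(\<lambda>j. integral {p..q} (radial_term a j)) sums integral {p..q} (\<lambda>\<theta>. cos \<theta> * sqrt (1 - a\<^sup>2 * (sin \<theta>)\<^sup>2))"
proof -
  have cont: "continuous_on A (radial_term a j)" for A j
    by (rule cosine_polys_continuous[OF radial_term_in_cosine_polys])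
  have "uniform_limit {p..q} (\<lambda>N \<theta>. \<Sum>j<N. radial_term a j \<theta>) (\<lambda>\<theta>. \<Sum>j. radial_term a j \<theta>) sequentially"
    using assms
    by (intro Weierstrass_m_test[where M = "\<lambda>j. (a\<^sup>2) ^ j"] summable_geometric)
       (auto simp: abs_square_less_1 abs_radial_term_le)
  then have "uniform_limit {p..q} (\<lambda>N \<theta>. \<Sum>j<N. radial_term a j \<theta>) (\<lambda>\<theta>. cos \<theta> * sqrt (1 - a\<^sup>2 * (sin \<theta>)\<^sup>2)) sequentially"
    using radial_terms_sums[OF assms] by (simp add: sums_iff)
  then obtain I J where IJ: "\<And>N. ((\<lambda>\<theta>. \<Sum>j<N. radial_term a j \<theta>) has_integral I N) {p..q}"
      "((\<lambda>\<theta>. cos \<theta> * sqrt (1 - a\<^sup>2 * (sin \<theta>)\<^sup>2)) has_integral J) {p..q}" "I \<longlonglongrightarrow> J"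
    by (rule uniform_limit_integral) (auto intro!: continuous_intros cont)
  \<comment> \<open>The values \<open>I N\<close> were only obtained abstractly; uniqueness of the
    integral identifies them as partial sums.\<close>
  have "I = (\<lambda>N. \<Sum>j<N. integral {p..q} (radial_term a j))"
  proof
    fix N
    have "((\<lambda>\<theta>. \<Sum>j<N. radial_term a j \<theta>) has_integral (\<Sum>j<N. integral {p..q} (radial_term a j))) {p..q}"
      by (intro has_integral_sum finite_lessThan integrable_integral integrable_continuous_real cont)
    then show "I N = (\<Sum>j<N. integral {p..q} (radial_term a j))"
      using IJ(1) by (rule has_integral_unique[rotated])
  qed
  then show ?thesis using IJ integral_unique[OF IJ(2)] by (simp add: sums_def)
qed

lemma alternating_integral_radial_terms_sums:
  assumes "0 < a" "a < 1"
  shows "(\<lambda>j. alternating_integral \<alpha> n (radial_term a j)) sums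
     alternating_integral \<alpha> n (\<lambda>\<theta>. cos \<theta> * sqrt (1 - a\<^sup>2 * (sin \<theta>)\<^sup>2))"
  unfolding alternating_integral_def
  by (intro sums_sum sums_mult integral_radial_terms_sums assms)

section \<open>Reduction of the inequity to the square root term\<close>

lemma scaled_inequity_eq:
  assumes "0 < a" "a < 1" "n > 1" "odd n"
  shows "scaled_inequity \<alpha> a n = alternating_integral \<alpha> n (\<lambda>\<theta>. cos \<theta> * sqrt (1 - a\<^sup>2 * (sin \<theta>)\<^sup>2))"
proof -
  let ?C = "\<lambda>\<theta>. cos \<theta> * sqrt (1 - a\<^sup>2 * (sin \<theta>)\<^sup>2)"
  let ?I = "\<lambda>k::nat. {\<alpha> + (real k - 1) * pi / real n .. \<alpha> + real k * pi / real n}"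
  let ?m = "\<lambda>k. measure lebesgue (slice \<alpha> a n k)"
  have "pizza_inequity \<alpha> a n = (\<Sum>k\<in>{1..2*n}. if even k then ?m k else - ?m k)"
    unfolding pizza_inequity_def
    by (simp add: sum.If_cases sum_negf Int_def Collect_conj_eq[symmetric])
  also have "\<dots> = (\<Sum>k\<in>{1..2*n}. (-1) ^ k * (integral (?I k) (\<lambda>\<theta>. (pizza_radius a \<theta>)\<^sup>2) / 2))"
    using assms by (intro sum.cong) (auto simp: measure_slice)
  also have "\<dots> = alternating_integral \<alpha> n (\<lambda>\<theta>. (pizza_radius a \<theta>)\<^sup>2) / 2"
    by (simp add: alternating_integral_def sum_divide_distrib)
  \<comment> \<open>The constant 1 is written as a cosine of frequency 0, and 2 as
    \<open>real 2\<close>, to match \<open>alternating_integral_cos\<close>.\<close>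
  also have "(\<lambda>\<theta>. (pizza_radius a \<theta>)\<^sup>2) = (\<lambda>\<theta>. (cos (real 0 * \<theta>) + a\<^sup>2 * cos (real 2 * \<theta>)) + (2 * a) * ?C \<theta>)"
  proof
    fix \<theta>
    have sq: "(sqrt (1 - a\<^sup>2 * (sin \<theta>)\<^sup>2))\<^sup>2 = 1 - a\<^sup>2 * (sin \<theta>)\<^sup>2"
      using one_minus_mult_sin_square_pos[OF assms(1,2), of \<theta>] by simp
    have cos_2: "cos (real 2 * \<theta>) = (cos \<theta>)\<^sup>2 - (sin \<theta>)\<^sup>2"
      by (simp add: cos_double)
    show "(pizza_radius a \<theta>)\<^sup>2 = (cos (real 0 * \<theta>) + a\<^sup>2 * cos (real 2 * \<theta>)) + (2 * a) * ?C \<theta>"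
      unfolding pizza_radius_def power2_sum sq cos_2 by (simp add: power_mult_distrib algebra_simps)
  qed
  also have "alternating_integral \<alpha> n \<dots> = alternating_integral \<alpha> n (\<lambda>\<theta>. cos (real 0 * \<theta>))
      + a\<^sup>2 * alternating_integral \<alpha> n (\<lambda>\<theta>. cos (real 2 * \<theta>)) + 2 * a * alternating_integral \<alpha> n ?C"
  proof -
    have "continuous_on UNIV (\<lambda>\<theta>. cos (real l * \<theta>))" "continuous_on UNIV (\<lambda>\<theta>. a\<^sup>2 * cos (real l * \<theta>))"
      "continuous_on UNIV (\<lambda>\<theta>. (2 * a) * ?C \<theta>)" for l
      by (intro continuous_intros)+
    then show ?thesis
      by (simp only: alternating_integral_add alternating_integral_mult continuous_on_add)
  qed
  also have "\<dots> = 2 * a * alternating_integral \<alpha> n ?C"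
  proof -
    \<comment> \<open>Odd multiples of an odd number are odd, which rules out the frequencies 0 and
      2.\<close>
    have "odd m" if "m \<in> odd_multiples n" for m
      using that assms(4) by (auto simp: odd_multiples_def)
    then have "0 \<notin> odd_multiples n" "2 \<notin> odd_multiples n"
      using even_zero even_numeral by blast+
    then show ?thesis using assms(3) by (simp add: alternating_integral_cos del: of_nat_0 of_nat_numeral)
  qed
  finally show ?thesis using assms by (simp add: scaled_inequity_def)
qed

section \<open>The double series and its two orders of summation\<close>

theorem theorem1p2:
  fixes n :: nat and a \<alpha> :: real
  assumes "n > 1" and "odd n"
    and "0 < a" and "a < 1"
    and "0 \<le> \<alpha>" and "\<alpha> < 2 * pi"
  shows "(\<forall>m\<in>odd_multiples n. summable (\<lambda>j. pizza_coeff m (Suc j) * a ^ (2 * Suc j)))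
    \<and> ((\<lambda>m. 4 * real n / (pi * real m) * pizza_series m a * sin (real m * \<alpha>))
         has_sum scaled_inequity \<alpha> a n) (odd_multiples n)"
proof (intro conjI ballI)
  define c where "c m j = pizza_coeff m j * a ^ (2*j)" for m j
  have c_norm: "summable (\<lambda>j. norm (c m j))" for m
    unfolding c_def by (rule pizza_coeff_summable[OF assms(3,4)])
  have c: "summable (c m)" for m
    using summable_norm_cancel[OF c_norm] .
  then show "summable (\<lambda>j. pizza_coeff m (Suc j) * a ^ (2 * Suc j))" for m
    using summable_Suc_iff[of "c m"] by (simp add: c_def)
  have m_gt: "m > 1" if "m \<in> odd_multiples n" for m
    using that assms(1) by (auto simp: odd_multiples_def elim!: oddE)
  have c_0: "c m j = 0" if "2*j + 1 < m" for m j
    using cosine_polys_orthogonal[OF radial_term_in_cosine_polys that] by (simp add: c_def radial_term_coeff)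
  \<comment> \<open>The sum of \<open>c m\<close> starts at j = 0 and \<open>pizza_series\<close> at
    j = 1; they agree because the term j = 0 vanishes for m > 1.\<close>
  have series: "suminf (c m) = pizza_series m a" if "m \<in> odd_multiples n" for m
    using suminf_split_head[OF c[of m]] c_0[of 0 m] m_gt[OF that]
    by (simp add: pizza_series_def c_def)
  define w where "w m = 4 * real n / (pi * real m) * sin (real m * \<alpha>)" for m
  let ?O = "\<lambda>j. odd_multiples n \<inter> {..2*j + 1}"
  have w_c: "norm (w m * c m j) \<le> 8 * real n * (a\<^sup>2) ^ j" if "m \<in> odd_multiples n" for m j
  proof -
    have "norm (w m * c m j) = (4 * real n / pi) * (\<bar>sin (real m * \<alpha>)\<bar> / real m) * \<bar>c m j\<bar>"
      by (simp add: w_def abs_mult)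
    \<comment> \<open>The final constant 8n is (4n / pi) times 2 pi; the middle factor is at most 1
      because m > 1.\<close>
    also have "\<dots> \<le> (4 * real n / pi) * 1 * (2 * pi * (a\<^sup>2) ^ j)"
    proof (intro mult_mono)
      have "\<bar>sin (real m * \<alpha>)\<bar> \<le> real m" using abs_sin_le_one[of "real m * \<alpha>"] m_gt[OF that] by linarith
      then show "\<bar>sin (real m * \<alpha>)\<bar> / real m \<le> 1" using m_gt[OF that] by simp
      show "\<bar>c m j\<bar> \<le> 2 * pi * (a\<^sup>2) ^ j" unfolding c_def by (rule abs_pizza_coeff_le[OF assms(3)])
    qed auto
    finally show ?thesis by simp
  qed
  \<comment> \<open>For fixed j only the indices m <= 2j + 1 matter, so each row of the double
    family is a finite sum.\<close>
  have has_sum_finite_support: "(f has_sum sum f (?O j)) (odd_multiples n)" if "\<And>m. 2*j + 1 < m \<Longrightarrow> f m = 0"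
    for f :: "nat \<Rightarrow> real" and j
    by (rule has_sum_cong_neutral[THEN iffD1, OF _ _ _ has_sum_finite[of "?O j"]])
       (use that in auto)
  have row: "((\<lambda>m. w m * c m j) has_sum alternating_integral \<alpha> n (radial_term a j)) (odd_multiples n)" for j
  proof -
    have "alternating_integral \<alpha> n (radial_term a j) = (\<Sum>m\<in>?O j. w m * c m j)"
      using assms(1) by (subst alternating_integral_cosine_poly[OF radial_term_in_cosine_polys])
                        (simp_all add: radial_term_coeff w_def c_def)
    then show ?thesis using has_sum_finite_support[of j "\<lambda>m. w m * c m j"] c_0 by simp
  qed
  have norm_row: "((\<lambda>m. norm (w m * c m j)) has_sum (\<Sum>m\<in>?O j. norm (w m * c m j))) (odd_multiples n)" for j
    by (rule has_sum_finite_support) (simp add: c_0)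
  have row_le: "(\<Sum>m\<in>?O j. norm (w m * c m j)) \<le> 16 * real n * (real (Suc j) * (a\<^sup>2) ^ j)" for j
  proof -
    have "(\<Sum>m\<in>?O j. norm (w m * c m j)) \<le> real (card (?O j)) * (8 * real n * (a\<^sup>2) ^ j)"
      by (rule sum_bounded_above) (use w_c in auto)
    \<comment> \<open>The set of indices up to 2j + 1, with 0 included, has 2j + 2 elements.\<close>
    also have "\<dots> \<le> real (2 * Suc j) * (8 * real n * (a\<^sup>2) ^ j)"
    proof (intro mult_right_mono)
      have "card (?O j) \<le> card {..2*j+1}" by (intro card_mono) auto
      then show "real (card (?O j)) \<le> real (2 * Suc j)" by simp
    qed auto
    also have "\<dots> = 16 * real n * (real (Suc j) * (a\<^sup>2) ^ j)" by (simp add: algebra_simps)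
    finally show ?thesis .
  qed
  have major: "summable (\<lambda>j. 16 * real n * (real (Suc j) * (a\<^sup>2) ^ j))"
    \<comment> \<open>The majorant is a multiple of the derivative of the geometric series at a^2 <
      1.\<close>
    using geometric_deriv_sums[of "a\<^sup>2"] assms by (intro summable_mult) (auto simp: sums_iff abs_square_less_1)
  have norm_rows: "summable (\<lambda>j. \<Sum>m\<in>?O j. norm (w m * c m j))"
    by (rule summable_comparison_test'[OF major]) (use row_le in \<open>simp add: sum_nonneg\<close>)
  have abs: "(\<lambda>(j, m). norm (w m * c m j)) summable_on UNIV \<times> odd_multiples n"
  proof (rule summable_on_SigmaI)
    show "(\<lambda>j. \<Sum>m\<in>?O j. norm (w m * c m j)) summable_on UNIV"
      using norm_rows by (intro norm_summable_imp_summable_on) (simp add: sum_nonneg)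
  qed (use norm_row in auto)
  have "(\<lambda>(j, m). w m * c m j) summable_on UNIV \<times> odd_multiples n"
    by (rule abs_summable_summable) (use abs in \<open>simp add: case_prod_unfold\<close>)
  moreover have "((\<lambda>j. alternating_integral \<alpha> n (radial_term a j)) has_sum scaled_inequity \<alpha> a n) UNIV"
  proof (rule norm_summable_imp_has_sum)
    show "(\<lambda>j. alternating_integral \<alpha> n (radial_term a j)) sums scaled_inequity \<alpha> a n"
      using alternating_integral_radial_terms_sums[OF assms(3,4)] scaled_inequity_eq[OF assms(3,4,1,2)] by simp
    \<comment> \<open>A row sum is bounded by the sum of the norms in its row, so the same majorant
      upgrades \<open>sums\<close> to the unconditional \<open>has_sum\<close>.\<close>
    have "norm (alternating_integral \<alpha> n (radial_term a j)) \<le> 16 * real n * (real (Suc j) * (a\<^sup>2) ^ j)" for j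
      using norm_has_sum_bound[OF norm_row row] row_le[of j] by (rule order_trans)
    then show "summable (\<lambda>j. norm (alternating_integral \<alpha> n (radial_term a j)))"
      by (intro summable_comparison_test'[OF major]) simp
  qed
  moreover have "((\<lambda>m. case (j, m) of (j, m) \<Rightarrow> w m * c m j) has_sum
      alternating_integral \<alpha> n (radial_term a j)) (odd_multiples n)" for j
    unfolding prod.case by (rule row)
  ultimately have "((\<lambda>(j, m). w m * c m j) has_sum scaled_inequity \<alpha> a n) (UNIV \<times> odd_multiples n)"
    by (intro has_sum_SigmaI)
  \<comment> \<open>Exchanging the coordinates makes m the outer index; summing over j first then
    produces the power series.\<close>
  then have "((\<lambda>(m, j). w m * c m j) has_sum scaled_inequity \<alpha> a n) (odd_multiples n \<times> UNIV)"
    by (subst (asm) has_sum_swap) simp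
  moreover have "((\<lambda>j. case (m, j) of (m, j) \<Rightarrow> w m * c m j) has_sum w m * suminf (c m)) UNIV" for m
    unfolding prod.case
    by (intro has_sum_cmult_right norm_summable_imp_has_sum c_norm summable_sums c)
  ultimately have "((\<lambda>m. w m * suminf (c m)) has_sum scaled_inequity \<alpha> a n) (odd_multiples n)"
    by (rule has_sum_SigmaD)
  then show "((\<lambda>m. 4 * real n / (pi * real m) * pizza_series m a * sin (real m * \<alpha>))
         has_sum scaled_inequity \<alpha> a n) (odd_multiples n)"
    by (rule has_sum_cong[THEN iffD1, rotated]) (simp add: w_def series)
qed

end
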